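(* There exists a continuum of fixed points of the renormalization operator $R$ acting on $C^{1+Lip}$ symmetric bimodal maps; that is, there is a family, indexed by a nondegenerate real interval, of pairwise distinct $C^{1+Lip}$ symmetric bimodal maps $g$ with $Rg=g$.
   Context: **Class of maps.** $C^{1+Lip}$ means $C^1$ with Lipschitz derivative. A $C^{1+Lip}$ symmetric bimodal map is a $C^{1+Lip}$ map $b:[0,1]\to[0,1]$ with $b(1-x)=1-b(x)$ and critical points $c_l<c_r=1-c_l$, strictly decreasing on $[0,c_l]$, strictly increasing on $[c_l,c_r]$, strictly decreasing on $[c_r,1]$, with $b(c_l)=0$, $b(c_r)=1$. Put $q=b(0)$, $I_L=[0,q]$, $I_R=[1-q,1]$; it is assumed that $c_l<q<\frac12$ and $b(I_L)\subset I_L$ (hence $b(I_R)\subset I_R$), so $b|_{I_L}$ and $b|_{I_R}$ are unimodal. **Renormalization (period tripling type).** $b$ is renormalizable if, with $I_l=[b^5(0),b^2(0)]$ and $I_r=1-I_l=[b^2(1),b^5(1)]$ (where $b^k$ is the $k$-th iterate, and $b^5(0)<b^2(0)$), one has $c_l\in I_l$, $c_r\in I_r$; $I_l,b(I_l),b^2(I_l)$ are pairwise disjoint and $I_r,b(I_r),b^2(I_r)$ are pairwise disjoint; $b^3(I_l)\subset I_l$ and $b^3(I_r)\subset I_r$. Let $h_l:I_L\to I_l$ and $h_r:I_R\to I_r$ be the orientation-reversing affine bijections. The renormalization $Rb$ is the symmetric bimodal map equal to $h_l^{-1}\circ b^3\circ h_l$ on $I_L$ and to $h_r^{-1}\circ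 b^3\circ h_r$ on $I_R$, these two unimodal pieces being joined over the gap $[q,1-q]$ by an increasing $C^{1+Lip}$ curve. Since the joining curve is a free choice, $Rb$ is regarded as determined by its restriction to $I_L\cup I_R$; $Rg=g$ means equality on $I_L\cup I_R$. Two fixed points $g_1,g_2$ count as distinct only if $g_1(0)\neq g_2(0)$ or they differ somewhere on $I_L\cup I_R$. *)

theory Defs
  imports "HOL-Analysis.Analysis"
begin

text \<open>Maps of \<open>[0,1]\<close> are functions on \<open>real\<close> of which only the values on \<open>{0..1}\<close> matter;
  derivatives are taken within \<open>{0..1}\<close>, hence one-sided at the end points.\<close>

definition C1_Lip_deriv :: "(real \<Rightarrow> real) \<Rightarrow> (real \<Rightarrow> real) \<Rightarrow> bool" where
  "C1_Lip_deriv b b' \<longleftrightarrow>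
     (\<forall>x\<in>{0..1}. (b has_real_derivative b' x) (at x within {0..1})) \<and>
     (\<exists>L. L-lipschitz_on {0..1} b')"

definition I_L :: "(real \<Rightarrow> real) \<Rightarrow> real set" where
  "I_L b = {0..b 0}"

definition I_R :: "(real \<Rightarrow> real) \<Rightarrow> real set" where
  "I_R b = {1 - b 0..1}"

text \<open>The parameter \<open>c\<close> is the left critical point \<open>c\<^sub>l\<close>, and \<open>c\<^sub>r = 1 - c\<close>. These two points are
  exactly the zeros of the derivative on \<open>[0,1]\<close>. The last line is the standing
  assumption \<open>c\<^sub>l < q < 1/2\<close>, \<open>b(I\<^sub>L) \<subseteq> I\<^sub>L\<close> with \<open>q = b 0\<close>; it forces \<open>0 < c\<close>.\<close>

definition symmetric_bimodal_crit :: "(real \<Rightarrow> real) \<Rightarrow> real \<Rightarrow> bool" where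
  "symmetric_bimodal_crit b c \<longleftrightarrow>
     b ` {0..1} \<subseteq> {0..1} \<and>
     (\<forall>x\<in>{0..1}. b (1 - x) = 1 - b x) \<and>
     0 \<le> c \<and> c < 1 - c \<and>
     (\<exists>b'. C1_Lip_deriv b b' \<and> {x\<in>{0..1}. b' x = 0} = {c, 1 - c}) \<and>
     strict_antimono_on {0..c} b \<and>
     strict_mono_on {c..1 - c} b \<and>
     strict_antimono_on {1 - c..1} b \<and>
     b c = 0 \<and> b (1 - c) = 1 \<and>
     c < b 0 \<and> b 0 < 1/2 \<and> b ` I_L b \<subseteq> I_L b"

definition symmetric_bimodal :: "(real \<Rightarrow> real) \<Rightarrow> bool" where
  "symmetric_bimodal b \<longleftrightarrow> (\<exists>c. symmetric_bimodal_crit b c)"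

definition I_l :: "(real \<Rightarrow> real) \<Rightarrow> real set" where
  "I_l b = {(b ^^ 5) 0..(b ^^ 2) 0}"

definition I_r :: "(real \<Rightarrow> real) \<Rightarrow> real set" where
  "I_r b = {(b ^^ 2) 1..(b ^^ 5) 1}"

text \<open>The point \<open>c\<close> is determined by \<open>b\<close>, so the quantifier over \<open>c\<close> merely names it.\<close>

definition renormalizable :: "(real \<Rightarrow> real) \<Rightarrow> bool" where
  "renormalizable b \<longleftrightarrow>
     (\<exists>c. symmetric_bimodal_crit b c \<and> c \<in> I_l b \<and> 1 - c \<in> I_r b) \<and>
     (b ^^ 5) 0 < (b ^^ 2) 0 \<and>
     I_l b \<inter> b ` I_l b = {} \<and> I_l b \<inter> (b ^^ 2) ` I_l b = {} \<and>
     b ` I_l b \<inter> (b ^^ 2) ` I_l b = {} \<and>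
     I_r b \<inter> b ` I_r b = {} \<and> I_r b \<inter> (b ^^ 2) ` I_r b = {} \<and>
     b ` I_r b \<inter> (b ^^ 2) ` I_r b = {} \<and>
     (b ^^ 3) ` I_l b \<subseteq> I_l b \<and> (b ^^ 3) ` I_r b \<subseteq> I_r b"

text \<open>The orientation-reversing affine map taking \<open>[u,v]\<close> onto \<open>[s,t]\<close>.\<close>

definition rev_affine :: "real \<Rightarrow> real \<Rightarrow> real \<Rightarrow> real \<Rightarrow> real \<Rightarrow> real" where
  "rev_affine u v s t x = t - (t - s) * (x - u) / (v - u)"

definition h_l :: "(real \<Rightarrow> real) \<Rightarrow> real \<Rightarrow> real" where
  "h_l b = rev_affine 0 (b 0) ((b ^^ 5) 0) ((b ^^ 2) 0)"

definition h_r :: "(real \<Rightarrow> real) \<Rightarrow> real \<Rightarrow> real" where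
  "h_r b = rev_affine (1 - b 0) 1 ((b ^^ 2) 1) ((b ^^ 5) 1)"

text \<open>\<open>f\<close> is a version of \<open>R b\<close>. It has \<open>f 0 = b 0\<close>, and \<open>symmetric_bimodal f\<close> makes it an
  increasing \<open>C\<^sup>1\<^sup>+\<^sup>L\<^sup>i\<^sup>p\<close> curve over the gap \<open>[q, 1 - q]\<close>, where it is otherwise arbitrary;
  hence a relation rather than a function.\<close>

definition is_renormalization :: "(real \<Rightarrow> real) \<Rightarrow> (real \<Rightarrow> real) \<Rightarrow> bool" where
  "is_renormalization b f \<longleftrightarrow>
     renormalizable b \<and> symmetric_bimodal f \<and>
     (\<forall>x\<in>I_L b. f x = inv_into (I_L b) (h_l b) ((b ^^ 3) (h_l b x))) \<and>
     (\<forall>x\<in>I_R b. f x = inv_into (I_R b) (h_r b) ((b ^^ 3) (h_r b x)))"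

definition renormalization_fixed_point :: "(real \<Rightarrow> real) \<Rightarrow> bool" where
  "renormalization_fixed_point g \<longleftrightarrow>
     symmetric_bimodal g \<and>
     (\<exists>f. is_renormalization g f \<and> (\<forall>x\<in>I_L g \<union> I_R g. f x = g x))"

text \<open>Once \<open>g\<^sub>1 0 = g\<^sub>2 0\<close>, both maps have the same \<open>I\<^sub>L\<close> and \<open>I\<^sub>R\<close>.\<close>

definition distinct_maps :: "(real \<Rightarrow> real) \<Rightarrow> (real \<Rightarrow> real) \<Rightarrow> bool" where
  "distinct_maps g1 g2 \<longleftrightarrow>
     g1 0 \<noteq> g2 0 \<or> (\<exists>x\<in>I_L g1 \<union> I_R g1. g1 x \<noteq> g2 x)"

end

theory Submission
  imports Defs
begin

text \<open>
  On \<open>I_L\<close> write \<open>b x = q * phi (x / q)\<close> with \<open>phi\<close> unimodal on \<open>[0,1]\<close>. Being a renormalization fixed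
  point depends on \<open>phi\<close> alone, so a single \<open>phi\<close> gives a fixed point for every \<open>q < 1/2\<close>, and
  these differ in their value \<open>q\<close> at \<open>0\<close>.

  To find \<open>phi\<close>, let \<open>h x = 17/32 - x/4\<close>, with fixed point \<open>17/40\<close>, the critical point. If
  \<open>phi\<close> is affine on \<open>[0,1/16]\<close> (slope \<open>- 4\<close>) and on \<open>[3/4,1]\<close> (slope \<open>1\<close>) with
  \<open>phi 0 = 1\<close>, \<open>phi 1 = 17/32\<close>, then \<open>phi\<^sup>2 v = h (16 v)\<close> on \<open>[0,1/16]\<close>, and the fixed point
  equation \<open>phi\<^sup>3 \<circ> h = h \<circ> phi\<close> reduces to \<open>phi (h x) = phi x / 16\<close>. The latter determines
  \<open>phi\<close> on \<open>h [0,1]\<close> from its values outside. As \<open>16 = 4\<^sup>2\<close>, the slope satisfies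
  \<open>phi' (h x) = - phi' x / 4\<close>, so rescaling preserves Lipschitz bounds for \<open>phi'\<close>, and \<open>phi'\<close>
  is obtained as a limit of uniformly Lipschitz functions.
\<close>

section \<open>Calculus on a closed interval\<close>

text \<open>\<open>phi\<close> and \<open>bimodal q\<close> are defined as integrals, so their
  explicit pieces and functional equations are obtained by comparing slopes and one value.\<close>

lemma antiderivative_unique_on_interval:
  fixes f g d :: "real \<Rightarrow> real"
  assumes f: "\<And>x. x \<in> {a..b} \<Longrightarrow> (f has_real_derivative d x) (at x within {a..b})"
    and g: "\<And>x. x \<in> {a..b} \<Longrightarrow> (g has_real_derivative d x) (at x within {a..b})"
    and z: "z \<in> {a..b}" "f z = g z" and x: "x \<in> {a..b}"
  shows "f x = g x"
proof -
  have "((\<lambda>y. f y - g y) has_real_derivative 0) (at y within {a..b})" if "y \<in> {a..b}" for y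
    using DERIV_diff[OF f g, of y] that by simp
  then obtain k where "\<forall>y\<in>{a..b}. f y - g y = k"
    using has_field_derivative_zero_constant[of "{a..b}" "\<lambda>y. f y - g y"] by auto
  with z x have "f z - g z = k" "f x - g x = k" by blast+
  with z(2) show ?thesis by simp
qed

text \<open>The sign is required only in the interior because the slopes in question vanish at
  critical end points.\<close>

lemma strict_mono_on_if_deriv_pos:
  fixes f d :: "real \<Rightarrow> real"
  assumes f: "\<And>x. x \<in> {a..b} \<Longrightarrow> (f has_real_derivative d x) (at x within {a..b})"
    and pos: "\<And>x. a < x \<Longrightarrow> x < b \<Longrightarrow> 0 < d x"
  shows "strict_mono_on {a..b} f"
proof (rule monotone_onI)
  fix x y assume xy: "x \<in> {a..b}" "y \<in> {a..b}" "x < y"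
  have "continuous_on {a..b} f"
    using f by (rule DERIV_continuous_on)
  then have "continuous_on {x..y} f"
    by (rule continuous_on_subset) (use xy in auto)
  moreover have "\<exists>e. (f has_real_derivative e) (at z) \<and> 0 < e" if "x < z" "z < y" for z
    using f[of z] pos[of z] xy that by (auto simp: at_within_Icc_at)
  ultimately show "f x < f y"
    using DERIV_pos_imp_increasing_open[OF xy(3)] by blast
qed

lemma strict_antimono_on_if_deriv_neg:
  fixes f d :: "real \<Rightarrow> real"
  assumes f: "\<And>x. x \<in> {a..b} \<Longrightarrow> (f has_real_derivative d x) (at x within {a..b})"
    and neg: "\<And>x. a < x \<Longrightarrow> x < b \<Longrightarrow> d x < 0"
  shows "strict_antimono_on {a..b} f"
proof -
  have "strict_mono_on {a..b} (\<lambda>x. - f x)"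
    using f neg by (intro strict_mono_on_if_deriv_pos[where d = "\<lambda>x. - d x"] DERIV_minus) auto
  then show ?thesis by (auto simp: monotone_on_def)
qed

section \<open>The slope of the unimodal map\<close>

text \<open>
  The slope on \<open>[0,1]\<close> before rescaling: \<open>- 4\<close> on \<open>[0,63/320]\<close>, \<open>1\<close> on \<open>[17/32,1]\<close>. The break
  point \<open>63/320\<close> is what makes \<open>phi (9/32) = phi 1 / 16\<close>; on \<open>[9/32,17/32]\<close> any Lipschitz
  function with the same values at the end points would do.
\<close>

definition base_slope :: "real \<Rightarrow> real" where
  "base_slope x = max (- 4) (min 1 (min (- 1/4 + 400/9 * (x - 9/32)) (- 1/4 + 5 * (x - 9/32))))"

text \<open>Iterates of the operator whose fixed-point equation is
  \<open>slope (h x) = - slope x / 4\<close>: [9/32,17/32] is \<open>h [0,1]\<close>, and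
  \<open>17/8 - 4 * x\<close> is the inverse of \<open>h\<close>.\<close>

fun slope_approx :: "nat \<Rightarrow> real \<Rightarrow> real" where
  "slope_approx 0 x = base_slope x"
| "slope_approx (Suc n) x =
     (if 9/32 \<le> x \<and> x \<le> 17/32 then - slope_approx n (17/8 - 4 * x) / 4 else base_slope x)"

definition slope :: "real \<Rightarrow> real" where
  "slope x = lim (\<lambda>n. slope_approx n x)"

lemma base_slope_simps:
  "x \<le> 63/320 \<Longrightarrow> base_slope x = - 4"
  "63/320 \<le> x \<Longrightarrow> x \<le> 9/32 \<Longrightarrow> base_slope x = - 1/4 + 400/9 * (x - 9/32)"
  "17/32 \<le> x \<Longrightarrow> base_slope x = 1"
proof -
  \<comment> \<open>Both lines pass through (9/32, -1/4). The steeper \<open>u\<close> is the lower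
    one to the left and reaches -4 at 63/320; \<open>v\<close> is the lower one to the right and
    reaches 1 at 17/32.\<close>
  define u v where uv: "u = - 1/4 + 400/9 * (x - 9/32)" "v = - 1/4 + 5 * (x - 9/32)"
  have eq: "base_slope x = max (- 4) (min 1 (min u v))"
    by (simp only: base_slope_def uv)
  show "base_slope x = - 4" if "x \<le> 63/320"
  proof -
    have "u \<le> - 4" using that by (simp add: uv field_simps)
    then show ?thesis by (simp add: eq min_def max_def)
  qed
  show "base_slope x = - 1/4 + 400/9 * (x - 9/32)" if "63/320 \<le> x" "x \<le> 9/32"
  proof -
    have "- 4 \<le> u" "u \<le> v" "u \<le> 1" using that by (simp_all add: uv field_simps)
    then have "base_slope x = u" by (simp add: eq min_def max_def)
    then show ?thesis by (simp only: uv)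
  qed
  show "base_slope x = 1" if "17/32 \<le> x"
  proof -
    have "1 \<le> u" "1 \<le> v" using that by (simp_all add: uv field_simps)
    then show ?thesis by (simp add: eq min_def max_def)
  qed
qed

lemma lipschitz_base_slope: "45-lipschitz_on X base_slope"
proof (rule lipschitz_on_leI)
  fix x y :: real assume "x \<le> y"
  \<comment> \<open>Minima and clamping preserve a common bound \<open>e\<close> on growth; 45
    exceeds the steepest rate 400/9.\<close>
  have clamp: "max (- 4) (min 1 (min u' v')) \<le> max (- 4) (min 1 (min u v)) + e"
    if "u' \<le> u + e" "v' \<le> v + e" "0 \<le> e" for u u' v v' e :: real
    using that by (auto simp: max_def min_def)
  have "base_slope x \<le> base_slope y"
    unfolding base_slope_def using \<open>x \<le> y\<close> by (intro max.mono min.mono order.refl) auto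
  moreover have "base_slope y \<le> base_slope x + 45 * (y - x)"
    unfolding base_slope_def using \<open>x \<le> y\<close> by (intro clamp) (simp_all add: field_simps)
  ultimately show "dist (base_slope x) (base_slope y) \<le> 45 * dist x y"
    using \<open>x \<le> y\<close> by (simp add: dist_real_def)
qed simp

text \<open>Multiplied by -1/4, these are the values of \<open>base_slope\<close> at 17/32 and 9/32,
  so the pieces of every approximation fit together.\<close>

lemma slope_approx_endpoints:
  "slope_approx n 0 = - 4" "slope_approx n 1 = 1"
  by (cases n; simp add: base_slope_simps)+

text \<open>The inverse of \<open>h\<close> stretches distances by 4 and the division by 4 undoes
  this, so the constant 45 survives every step; the pieces are glued at the break points.\<close>

lemma lipschitz_slope_approx: "45-lipschitz_on {0..1} (slope_approx n)"
proof (induction n)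
  case 0
  then show ?case using lipschitz_base_slope by (simp cong: lipschitz_on_cong)
next
  case (Suc n)
  have "45-lipschitz_on {9/32..17/32} (\<lambda>x. - slope_approx n (17/8 - 4 * x) / 4)"
  proof (rule lipschitz_onI)
    fix x y :: real assume "x \<in> {9/32..17/32}" "y \<in> {9/32..17/32}"
    then have "dist (slope_approx n (17/8 - 4 * x)) (slope_approx n (17/8 - 4 * y))
        \<le> 45 * dist (17/8 - 4 * x) (17/8 - 4 * y)"
      by (intro lipschitz_onD[OF Suc]) auto
    then show "dist (- slope_approx n (17/8 - 4 * x) / 4) (- slope_approx n (17/8 - 4 * y) / 4)
        \<le> 45 * dist x y"
      by (simp add: dist_real_def abs_if field_simps split: if_splits)
  qed simp
  from lipschitz_on_concat[OF lipschitz_on_concat[OF lipschitz_base_slope this] lipschitz_base_slope,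
      of 0 1]
  have "45-lipschitz_on {0..1} (\<lambda>x. if x \<le> 17/32 then if x \<le> 9/32 then base_slope x
      else - slope_approx n (17/8 - 4 * x) / 4 else base_slope x)"
    by (simp add: slope_approx_endpoints base_slope_simps)
  then show ?case
  proof (rule lipschitz_on_transform)
    show "slope_approx (Suc n) x = (if x \<le> 17/32 then if x \<le> 9/32 then base_slope x
        else - slope_approx n (17/8 - 4 * x) / 4 else base_slope x)" for x
    \<comment> \<open>At 9/32 the two sides choose different branches, both with value -1/4.\<close>
    proof (cases "x = 9/32")
      case True
      have "17/8 - 4 * (9/32) = (1::real)" by simp
      then show ?thesis
        unfolding True using base_slope_simps(2)[of "9/32"] by (simp add: slope_approx_endpoints)
    qed auto
  qed
qed

text \<open>One rescaling step divides differences by 4; the initial 8 is a crude bound from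
  \<open>base_slope\<close> lying in [-4,1].\<close>

lemma abs_slope_approx_diff:
  "x \<in> {0..1} \<Longrightarrow> \<bar>slope_approx (Suc n) x - slope_approx n x\<bar> \<le> 8 * (1/4) ^ n"
proof (induction n arbitrary: x)
  case 0
  have "- 4 \<le> base_slope y" "base_slope y \<le> 1" for y
    unfolding base_slope_def by simp_all
  from this[of x] this[of "17/8 - 4 * x"]
  have "\<bar>- base_slope (17/8 - 4 * x) / 4 - base_slope x\<bar> \<le> 8" by linarith
  then show ?case by simp
next
  case (Suc n)
  show ?case
  proof (cases "9/32 \<le> x \<and> x \<le> 17/32")
    case True
    have "\<bar>- a / 4 - - b / 4\<bar> = \<bar>a - b\<bar> / 4" for a b :: real
      by (simp add: abs_if)
    then show ?thesis
      using True Suc.IH[of "17/8 - 4 * x"]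
      by (simp del: slope_approx.simps add: slope_approx.simps(2)[of _ x])
  next
    case False
    then show ?thesis by (simp only: slope_approx.simps(2)) simp
  qed
qed

lemma slope_approx_tendsto:
  assumes "x \<in> {0..1}"
  shows "(\<lambda>n. slope_approx n x) \<longlonglongrightarrow> slope x"
proof -
  have "summable (\<lambda>n. 8 * (1/4 :: real) ^ n)"
    by (rule summable_mult) (rule summable_geometric, simp)
  then have "summable (\<lambda>n. slope_approx (Suc n) x - slope_approx n x)"
    by (rule summable_comparison_test') (use abs_slope_approx_diff[OF assms] in \<open>simp only: real_norm_def\<close>)
  then have "convergent (\<lambda>n. \<Sum>i<n. slope_approx (Suc i) x - slope_approx i x)"
    by (simp only: summable_iff_convergent)
  then have "convergent (\<lambda>n. slope_approx n x - slope_approx 0 x)"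
    by (simp only: sum_lessThan_telescope[of "\<lambda>n. slope_approx n x"])
  then show ?thesis
    unfolding slope_def convergent_LIMSEQ_iff[symmetric] by (simp add: convergent_diff_const_right_iff)
qed

lemma slope_outside:
  assumes "x \<in> {0..1}" "x \<le> 9/32 \<or> 17/32 \<le> x"
  shows "slope x = base_slope x"
proof -
  have "slope_approx n x = base_slope x" for n
  proof (cases n)
    case (Suc m)
    \<comment> \<open>The break points fall in the rescaled branch, but the inverse of
      \<open>h\<close> sends them to 1 and 0, where all approximations agree.\<close>
    have "17/8 - 4 * (9/32) = (1::real)" "17/8 - 4 * (17/32) = (0::real)" by simp_all
    then have "slope_approx n (9/32) = base_slope (9/32)" "slope_approx n (17/32) = base_slope (17/32)"
      using base_slope_simps(2)[of "9/32"] base_slope_simps(3)[of "17/32"]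
      by (simp_all add: Suc slope_approx_endpoints)
    moreover have "slope_approx n x = base_slope x" if "x < 9/32 \<or> 17/32 < x"
      using that by (auto simp: Suc)
    ultimately show ?thesis
      using assms(2) by (metis linorder_less_linear not_less)
  qed simp
  then show ?thesis by (simp add: slope_def limI)
qed

lemma slope_simps:
  "x \<in> {0..63/320} \<Longrightarrow> slope x = - 4"
  "x \<in> {63/320..9/32} \<Longrightarrow> slope x = - 1/4 + 400/9 * (x - 9/32)"
  "x \<in> {17/32..1} \<Longrightarrow> slope x = 1"
  by (simp_all add: slope_outside base_slope_simps)

lemma slope_rescale:
  assumes "x \<in> {0..1}"
  shows "slope (17/32 - x/4) = - slope x / 4"
proof (rule LIMSEQ_unique)
  show "(\<lambda>n. slope_approx (Suc n) (17/32 - x/4)) \<longlonglongrightarrow> slope (17/32 - x/4)"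
    using assms by (intro LIMSEQ_Suc slope_approx_tendsto) auto
  have "slope_approx (Suc n) (17/32 - x/4) = - slope_approx n x / 4" for n
    using assms by simp
  then show "(\<lambda>n. slope_approx (Suc n) (17/32 - x/4)) \<longlonglongrightarrow> - slope x / 4"
    by (simp only:) (intro tendsto_intros slope_approx_tendsto assms, simp)
qed

lemma lipschitz_slope: "45-lipschitz_on {0..1} slope"
proof (rule lipschitz_onI)
  fix x y :: real assume xy: "x \<in> {0..1}" "y \<in> {0..1}"
  have "(\<lambda>n. dist (slope_approx n x) (slope_approx n y)) \<longlonglongrightarrow> dist (slope x) (slope y)"
    using xy by (intro tendsto_dist slope_approx_tendsto)
  then show "dist (slope x) (slope y) \<le> 45 * dist x y"
    by (rule LIMSEQ_le_const2) (use lipschitz_onD[OF lipschitz_slope_approx xy] in blast)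
qed simp

text \<open>As 17/40 is fixed by \<open>h\<close>, rescaling makes the slope there equal to -1/4
  times itself.\<close>

lemma slope_critical: "slope (17/40) = 0"
proof -
  have "slope (17/32 - (17/40) / 4) = - slope (17/40) / 4"
    by (rule slope_rescale) simp
  moreover have "17/32 - (17/40) / 4 = (17/40 :: real)" by simp
  ultimately have "slope (17/40) = - slope (17/40) / 4" by (simp only:)
  then show ?thesis by linarith
qed

text \<open>The inverse of \<open>h\<close> multiplies the distance to 17/40 by 4, so it pushes any
  other point out of [9/32,17/32] in finitely many steps, bounded by \<open>n\<close>. Slope and
  displacement both change sign, so their product keeps its sign; outside, the slope is
  explicit.\<close>

lemma slope_sign:
  assumes "x \<in> {0..1}" "x \<noteq> 17/40"
  shows "0 < slope x * (x - 17/40)"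
proof -
  obtain n where n: "(1/4) ^ n < \<bar>x - 17/40\<bar>"
    using real_arch_pow_inv[of "\<bar>x - 17/40\<bar>" "1/4"] assms by auto
  from assms(1) n show ?thesis
  proof (induction n arbitrary: x)
    case 0
    \<comment> \<open>Vacuous: no point of [0,1] is farther than 1 from 17/40.\<close>
    then show ?case by (auto simp: abs_if split: if_splits)
  next
    case (Suc n)
    consider "9/32 \<le> x" "x \<le> 17/32" | "x < 9/32" | "17/32 < x" by linarith
    then show ?case
    proof cases
      case 1
      define y where "y = 17/8 - 4 * x"
      have y: "y \<in> {0..1}" "x = 17/32 - y/4" "y - 17/40 = - 4 * (x - 17/40)"
        using 1 by (auto simp: y_def field_simps)
      then have "(1/4) ^ n < \<bar>y - 17/40\<bar>"
        using Suc.prems(2) unfolding y(3) abs_mult by simp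
      have "slope x = - slope y / 4"
        unfolding y(2) by (rule slope_rescale[OF y(1)])
      then have "slope x * (x - 17/40) = slope y * (y - 17/40) / 16"
        unfolding y(3) by (simp add: algebra_simps)
      then show ?thesis using Suc.IH[OF y(1) \<open>(1/4) ^ n < \<bar>y - 17/40\<bar>\<close>] by simp
    next
      case 2
      have "slope x < 0"
        using 2 Suc.prems slope_simps(1,2)[of x] by (cases "x \<le> 63/320") auto
      then show ?thesis using 2 by (simp add: mult_neg_neg)
    next
      case 3
      then show ?thesis
        using Suc.prems slope_simps(3)[of x] by simp
    qed
  qed
qed

lemma slope_neg: "0 \<le> x \<Longrightarrow> x < 17/40 \<Longrightarrow> slope x < 0"
  using slope_sign[of x] by (auto simp: zero_less_mult_iff)

lemma slope_pos: "17/40 < x \<Longrightarrow> x \<le> 1 \<Longrightarrow> 0 < slope x"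
  using slope_sign[of x] by (auto simp: zero_less_mult_iff)

section \<open>The unimodal map \<open>phi\<close>\<close>

definition phi :: "real \<Rightarrow> real" where
  "phi x = 1 + integral {0..x} slope"

lemma phi_0: "phi 0 = 1"
  by (simp add: phi_def)

lemma phi_has_derivative:
  "x \<in> {0..1} \<Longrightarrow> (phi has_real_derivative slope x) (at x within {0..1})"
  unfolding phi_def
  by (auto intro!: derivative_eq_intros integral_has_real_derivative
      lipschitz_on_continuous_on[OF lipschitz_slope])

lemma phi_has_derivative_subset:
  "x \<in> X \<Longrightarrow> X \<subseteq> {0..1} \<Longrightarrow> (phi has_real_derivative slope x) (at x within X)"
  using phi_has_derivative by (blast intro: DERIV_subset)

lemma phi_left:
  assumes "x \<in> {0..63/320}"
  shows "phi x = 1 - 4 * x"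
proof (rule antiderivative_unique_on_interval[where a = 0 and b = "63/320" and z = 0
      and d = slope and g = "\<lambda>x. 1 - 4 * x"])
  fix y :: real assume y: "y \<in> {0..63/320}"
  show "(phi has_real_derivative slope y) (at y within {0..63/320})"
    using y by (intro phi_has_derivative_subset) auto
  show "((\<lambda>x. 1 - 4 * x) has_real_derivative slope y) (at y within {0..63/320})"
    using y by (auto intro!: derivative_eq_intros simp: slope_simps)
qed (use assms in \<open>auto simp: phi_0\<close>)

text \<open>The slope rises from -4 at 63/320 at rate 400/9, whence the quadratic term.\<close>

lemma phi_9_32: "phi (9/32) = 17/512"
proof -
  have "phi (9/32) = 1 - 4 * (9/32) + 200/9 * (9/32 - 63/320)\<^sup>2"
  proof (rule antiderivative_unique_on_interval
      [where a = "63/320" and b = "9/32" and z = "63/320" and d = slope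
        and g = "\<lambda>x. 1 - 4 * x + 200/9 * (x - 63/320)\<^sup>2"])
    fix y :: real assume y: "y \<in> {63/320..9/32}"
    show "(phi has_real_derivative slope y) (at y within {63/320..9/32})"
      using y by (intro phi_has_derivative_subset) auto
    show "((\<lambda>x. 1 - 4 * x + 200/9 * (x - 63/320)\<^sup>2) has_real_derivative slope y)
        (at y within {63/320..9/32})"
      using y by (auto intro!: derivative_eq_intros simp: slope_simps field_simps)
  qed (auto simp: phi_left)
  then show ?thesis by (simp add: power2_eq_square)
qed

lemma phi_right_diff:
  assumes "x \<in> {17/32..1}"
  shows "phi x = x - 17/32 + phi (17/32)"
proof (rule antiderivative_unique_on_interval
    [where a = "17/32" and b = 1 and z = "17/32" and d = slope
      and g = "\<lambda>x. x - 17/32 + phi (17/32)"])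
  fix y :: real assume y: "y \<in> {17/32..1}"
  show "(phi has_real_derivative slope y) (at y within {17/32..1})"
    using y by (intro phi_has_derivative_subset) auto
  show "((\<lambda>x. x - 17/32 + phi (17/32)) has_real_derivative slope y) (at y within {17/32..1})"
    using y by (auto intro!: derivative_eq_intros simp: slope_simps)
qed (use assms in auto)

text \<open>By the chain rule both functions of \<open>x\<close> have slope
  \<open>slope x / 16\<close>. The bracketed constant is read off at 0; \<open>phi_17_32\<close>
  makes it vanish.\<close>

lemma phi_rescale_diff:
  assumes "x \<in> {0..1}"
  shows "phi (17/32 - x/4) = phi x / 16 + (phi (17/32) - 1/16)"
proof (rule antiderivative_unique_on_interval
    [where a = 0 and b = 1 and z = 0 and d = "\<lambda>x. slope x / 16"
      and f = "\<lambda>x. phi (17/32 - x/4)" and g = "\<lambda>x. phi x / 16 + (phi (17/32) - 1/16)"])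
  fix y :: real assume y: "y \<in> {0..1}"
  have "(phi has_real_derivative slope (17/32 - y/4))
      (at (17/32 - y/4) within (\<lambda>y. 17/32 - y/4) ` {0..1})"
    using y by (intro phi_has_derivative_subset) auto
  moreover have "((\<lambda>y. 17/32 - y/4) has_real_derivative - 1/4) (at y within {0..1})"
    by (auto intro!: derivative_eq_intros)
  ultimately have "(phi \<circ> (\<lambda>y. 17/32 - y/4) has_real_derivative slope (17/32 - y/4) * (- 1/4))
      (at y within {0..1})"
    by (rule DERIV_image_chain)
  then show "((\<lambda>x. phi (17/32 - x/4)) has_real_derivative slope y / 16) (at y within {0..1})"
    using y by (simp add: slope_rescale o_def)
  show "((\<lambda>x. phi x / 16 + (phi (17/32) - 1/16)) has_real_derivative slope y / 16)
      (at y within {0..1})"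
    using y by (auto intro!: derivative_eq_intros phi_has_derivative)
qed (use assms in \<open>auto simp: phi_0\<close>)

text \<open>With \<open>phi (9/32)\<close> known, rescaling at 1 and the right-hand piece at 1 are
  two linear equations for \<open>phi 1\<close> and \<open>phi (17/32)\<close>.\<close>

lemma phi_17_32: "phi (17/32) = 1/16"
  using phi_rescale_diff[of 1] phi_right_diff[of 1] phi_9_32 by (simp add: field_simps)

lemma phi_right: "x \<in> {17/32..1} \<Longrightarrow> phi x = x - 15/32"
  using phi_right_diff[of x] by (simp add: phi_17_32)

lemma phi_rescale: "x \<in> {0..1} \<Longrightarrow> phi (17/32 - x/4) = phi x / 16"
  using phi_rescale_diff[of x] by (simp add: phi_17_32)

lemma phi_critical: "phi (17/40) = 0"
proof -
  have "phi (17/32 - (17/40) / 4) = phi (17/40) / 16"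
    by (rule phi_rescale) simp
  moreover have "17/32 - (17/40) / 4 = (17/40 :: real)" by simp
  ultimately have "phi (17/40) = phi (17/40) / 16" by (simp only:)
  then show ?thesis by linarith
qed

lemma phi_range:
  assumes "x \<in> {0..1}"
  shows "phi x \<in> {0..1}"
proof -
  have anti: "strict_antimono_on {0..17/40} phi"
  proof (rule strict_antimono_on_if_deriv_neg)
    show "slope y < 0" if "0 < y" "y < 17/40" for y
      using slope_neg[of y] that by simp
  qed (rule phi_has_derivative_subset, auto)
  have mono: "strict_mono_on {17/40..1} phi"
  proof (rule strict_mono_on_if_deriv_pos)
    show "0 < slope y" if "17/40 < y" "y < 1" for y
      using slope_pos[of y] that by simp
  qed (rule phi_has_derivative_subset, auto)
  consider "x = 17/40" | "x < 17/40" | "17/40 < x" by linarith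
  then show ?thesis
  proof cases
    case 1
    then show ?thesis by (simp only: phi_critical) simp
  next
    case 2
    then show ?thesis
      using assms monotone_onD[OF anti, of 0 x] monotone_onD[OF anti, of x "17/40"]
      by (cases "x = 0") (auto simp: phi_0 phi_critical)
  next
    case 3
    then show ?thesis
      using assms monotone_onD[OF mono, of x 1] monotone_onD[OF mono, of "17/40" x]
      by (cases "x = 1") (auto simp: phi_right phi_critical)
  qed
qed

text \<open>The orbit stays on the affine pieces: \<open>phi x / 16\<close> lies in [0,1/16], so the
  next value \<open>1 - phi x / 4\<close> lies in [3/4,1].\<close>

lemma phi_cube_rescale:
  assumes "x \<in> {0..1}"
  shows "phi (phi (phi (17/32 - x/4))) = 17/32 - phi x / 4"
  using phi_range[OF assms] assms by (simp add: phi_rescale phi_left phi_right)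

section \<open>Extension to a symmetric bimodal map\<close>

text \<open>
  In the gap \<open>[q,1/2]\<close> the slope grows linearly from \<open>1\<close>; its rate is chosen so that the graph
  passes through \<open>(1/2,1/2)\<close>, which lets it be continued by symmetry.
\<close>

definition gap_curvature :: "real \<Rightarrow> real" where
  "gap_curvature q = 15/16 / (1 / (2 * q) - 1)\<^sup>2"

definition extended_slope :: "real \<Rightarrow> real \<Rightarrow> real" where
  "extended_slope q v = (if v \<le> 1 then slope v else 1 + gap_curvature q * (v - 1))"

text \<open>Symmetry about (1/2,1/2) means a slope that is even about 1/2, obtained by folding with
  \<open>min\<close>; division by \<open>q\<close> turns [0,q] into the domain [0,1] of
  \<open>phi\<close>.\<close>

definition bimodal_slope :: "real \<Rightarrow> real \<Rightarrow> real" where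
  "bimodal_slope q x = extended_slope q (min x (1 - x) / q)"

definition bimodal :: "real \<Rightarrow> real \<Rightarrow> real" where
  "bimodal q x = q + integral {0..x} (bimodal_slope q)"

lemma bimodal_slope_symmetric: "bimodal_slope q (1 - x) = bimodal_slope q x"
  by (simp add: bimodal_slope_def min.commute)

lemma bimodal_0: "bimodal q 0 = q"
  by (simp add: bimodal_def)

lemma gap_curvature_nonneg: "0 \<le> gap_curvature q"
  by (simp add: gap_curvature_def)

context
  fixes q :: real
  assumes q: "0 < q" "q < 1/2"
begin

lemma bimodal_slope_left: "x \<in> {0..q} \<Longrightarrow> bimodal_slope q x = slope (x / q)"
  using q by (simp add: bimodal_slope_def extended_slope_def min_def)

lemma bimodal_slope_gap:
  "x \<in> {q..1/2} \<Longrightarrow> bimodal_slope q x = 1 + gap_curvature q * (x / q - 1)"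
  using q by (cases "x = q") (auto simp: bimodal_slope_def extended_slope_def slope_simps min_def)

text \<open>Both pieces of \<open>extended_slope\<close> have value 1 at 1, and the folding is
  Lipschitz with constant \<open>1 / q\<close>.\<close>

lemma lipschitz_bimodal_slope: "\<exists>L. L-lipschitz_on {0..1} (bimodal_slope q)"
proof -
  have "(gap_curvature q)-lipschitz_on {1..1 / q} (\<lambda>v. 1 + gap_curvature q * (v - 1))"
    using gap_curvature_nonneg[of q]
    by (intro lipschitz_onI)
       (auto simp: dist_real_def abs_mult right_diff_distrib[symmetric])
  from lipschitz_on_concat_max[OF lipschitz_slope this]
  have ext: "(max (45) (gap_curvature q))-lipschitz_on {0..1 / q} (extended_slope q)"
    by (simp add: extended_slope_def[abs_def] slope_simps)
  have "(1 / q)-lipschitz_on {0..1} (\<lambda>x. min x (1 - x) / q)"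
  proof (rule lipschitz_onI)
    fix x y :: real
    have "\<bar>min x (1 - x) - min y (1 - y)\<bar> \<le> \<bar>x - y\<bar>" by linarith
    then have "\<bar>min x (1 - x) - min y (1 - y)\<bar> / q \<le> \<bar>x - y\<bar> / q"
      using q by (intro divide_right_mono) auto
    moreover have "dist (min x (1 - x) / q) (min y (1 - y) / q) = \<bar>min x (1 - x) - min y (1 - y)\<bar> / q"
      using q unfolding dist_real_def diff_divide_distrib[symmetric] abs_divide by simp
    ultimately show "dist (min x (1 - x) / q) (min y (1 - y) / q) \<le> 1 / q * dist x y"
      by (simp add: dist_real_def)
  qed (use q in simp)
  moreover have "(\<lambda>x. min x (1 - x) / q) ` {0..1} \<subseteq> {0..1 / q}"
    using q by (auto simp: divide_right_mono)
  ultimately show ?thesis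
    using lipschitz_on_compose2[OF _ lipschitz_on_subset[OF ext]]
    unfolding bimodal_slope_def[abs_def] by blast
qed

lemma bimodal_has_derivative:
  "x \<in> {0..1} \<Longrightarrow> (bimodal q has_real_derivative bimodal_slope q x) (at x within {0..1})"
  using lipschitz_bimodal_slope unfolding bimodal_def[abs_def]
  by (auto intro!: derivative_eq_intros integral_has_real_derivative lipschitz_on_continuous_on)

lemma bimodal_has_derivative_subset:
  "x \<in> X \<Longrightarrow> X \<subseteq> {0..1} \<Longrightarrow> (bimodal q has_real_derivative bimodal_slope q x) (at x within X)"
  using bimodal_has_derivative by (blast intro: DERIV_subset)

lemma bimodal_left:
  assumes "x \<in> {0..q}"
  shows "bimodal q x = q * phi (x / q)"
proof (rule antiderivative_unique_on_interval[where a = 0 and b = q and z = 0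
      and d = "bimodal_slope q" and f = "bimodal q" and g = "\<lambda>x. q * phi (x / q)"])
  fix y assume y: "y \<in> {0..q}"
  show "(bimodal q has_real_derivative bimodal_slope q y) (at y within {0..q})"
    using y q by (intro bimodal_has_derivative_subset) auto
  have "(phi has_real_derivative slope (y / q)) (at (y / q) within (\<lambda>x. x / q) ` {0..q})"
    using y q by (intro phi_has_derivative_subset) auto
  moreover have "((\<lambda>x. x / q) has_real_derivative 1 / q) (at y within {0..q})"
    using q by (auto intro!: derivative_eq_intros)
  ultimately have "(phi \<circ> (\<lambda>x. x / q) has_real_derivative slope (y / q) * (1 / q)) (at y within {0..q})"
    by (rule DERIV_image_chain)
  from DERIV_cmult[OF this, of q]
  show "((\<lambda>x. q * phi (x / q)) has_real_derivative bimodal_slope q y) (at y within {0..q})"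
    using y q by (simp add: bimodal_slope_left o_def)
qed (use assms q in \<open>auto simp: phi_0 bimodal_0\<close>)

lemma bimodal_scaled: "y \<in> {0..1} \<Longrightarrow> bimodal q (q * y) = q * phi y"
  using bimodal_left[of "q * y"] q by (auto simp: mult_left_le)

lemma bimodal_I_L_invariant: "x \<in> {0..q} \<Longrightarrow> bimodal q x \<in> {0..q}"
  using phi_range[of "x / q"] q by (simp add: bimodal_left mult_left_le)

text \<open>Continued from \<open>17/32 * q\<close> with slope 1, the graph would miss 1/2 by
  \<open>15/32 * q\<close>; the quadratic term in the gap supplies exactly this.\<close>

lemma bimodal_half: "bimodal q (1/2) = 1/2"
proof -
  have "bimodal q (1/2) =
      17/32 * q + (1/2 - q) + gap_curvature q * q / 2 * ((1/2) / q - 1)\<^sup>2"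
  proof (rule antiderivative_unique_on_interval[where a = q and b = "1/2" and z = q
        and d = "bimodal_slope q" and f = "bimodal q"
        and g = "\<lambda>x. 17/32 * q + (x - q) + gap_curvature q * q / 2 * (x / q - 1)\<^sup>2"])
    fix y assume y: "y \<in> {q..1/2}"
    show "(bimodal q has_real_derivative bimodal_slope q y) (at y within {q..1/2})"
      using y q by (intro bimodal_has_derivative_subset) auto
    show "((\<lambda>x. 17/32 * q + (x - q) + gap_curvature q * q / 2 * (x / q - 1)\<^sup>2)
        has_real_derivative bimodal_slope q y) (at y within {q..1/2})"
      using y q by (auto intro!: derivative_eq_intros simp: bimodal_slope_gap)
  qed (use q in \<open>auto simp: bimodal_left phi_right\<close>)
  also have "1 / (2 * q) - 1 \<noteq> 0"
    using q by (simp add: field_simps)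
  then have "gap_curvature q * ((1/2) / q - 1)\<^sup>2 = 15/16"
    by (simp add: gap_curvature_def)
  then have "gap_curvature q * q / 2 * ((1/2) / q - 1)\<^sup>2 = 15/32 * q"
    by (simp add: field_simps)
  finally show ?thesis by simp
qed

text \<open>The slope is even about 1/2, so the equation holds up to a constant, which
  \<open>bimodal_half\<close> shows to be zero.\<close>

lemma bimodal_symmetric:
  assumes "x \<in> {0..1}"
  shows "bimodal q (1 - x) = 1 - bimodal q x"
proof (rule antiderivative_unique_on_interval[where a = 0 and b = 1 and z = "1/2"
      and d = "\<lambda>x. - bimodal_slope q x" and f = "\<lambda>x. bimodal q (1 - x)"
      and g = "\<lambda>x. 1 - bimodal q x"])
  fix y :: real assume y: "y \<in> {0..1}"
  have "(bimodal q has_real_derivative bimodal_slope q (1 - y)) (at (1 - y) within (-) 1 ` {0..1})"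
    using y by (intro bimodal_has_derivative_subset) auto
  moreover have "((-) 1 has_real_derivative - 1) (at y within {0..1})"
    by (auto intro!: derivative_eq_intros)
  ultimately have
    "(bimodal q \<circ> (-) 1 has_real_derivative bimodal_slope q (1 - y) * - 1) (at y within {0..1})"
    by (rule DERIV_image_chain)
  then show "((\<lambda>x. bimodal q (1 - x)) has_real_derivative - bimodal_slope q y) (at y within {0..1})"
    by (simp add: o_def bimodal_slope_symmetric)
  show "((\<lambda>x. 1 - bimodal q x) has_real_derivative - bimodal_slope q y) (at y within {0..1})"
    using y by (auto intro!: derivative_eq_intros bimodal_has_derivative)
qed (use assms in \<open>auto simp: bimodal_half\<close>)

lemma bimodal_slope_neg:
  assumes "0 \<le> x" "x < 17/40 * q"
  shows "bimodal_slope q x < 0"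
  using slope_neg[of "x / q"] assms q by (simp add: bimodal_slope_left pos_divide_less_eq)

lemma bimodal_slope_pos:
  assumes "17/40 * q < x" "x < 1 - 17/40 * q"
  shows "0 < bimodal_slope q x"
proof -
  \<comment> \<open>On the gap the slope is at least 1; the right half follows by
    reflection.\<close>
  have left: "0 < bimodal_slope q y" if "17/40 * q < y" "y \<le> 1/2" for y
  proof (cases "y \<le> q")
    case True
    then show ?thesis
      using slope_pos[of "y / q"] that q by (simp add: bimodal_slope_left pos_less_divide_eq)
  next
    case False
    then have "0 \<le> gap_curvature q * (y / q - 1)"
      using q gap_curvature_nonneg by (intro mult_nonneg_nonneg) auto
    then show ?thesis using False that by (simp add: bimodal_slope_gap)
  qed
  show ?thesis
    using left[of x] left[of "1 - x"] assms by (cases "x \<le> 1/2") (auto simp: bimodal_slope_symmetric)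
qed

lemma symmetric_bimodal_crit_bimodal: "symmetric_bimodal_crit (bimodal q) (17/40 * q)"
proof -
  define c where "c = 17/40 * q"
  have c: "0 < c" "c < q" "c < 1 - c"
    using q by (auto simp: c_def)
  have zero: "bimodal q c = 0"
    using q by (simp add: c_def bimodal_left phi_critical)
  have slope_right_neg: "bimodal_slope q x < 0" if "1 - c < x" "x \<le> 1" for x
    using bimodal_slope_neg[of "1 - x"] that by (simp add: c_def bimodal_slope_symmetric)
  have anti_left: "strict_antimono_on {0..c} (bimodal q)"
    by (rule strict_antimono_on_if_deriv_neg[where d = "bimodal_slope q"])
       (use c in \<open>auto intro!: bimodal_has_derivative_subset bimodal_slope_neg simp: c_def\<close>)
  have mono: "strict_mono_on {c..1 - c} (bimodal q)"
    by (rule strict_mono_on_if_deriv_pos[where d = "bimodal_slope q"])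
       (use c in \<open>auto intro!: bimodal_has_derivative_subset bimodal_slope_pos simp: c_def\<close>)
  have anti_right: "strict_antimono_on {1 - c..1} (bimodal q)"
    by (rule strict_antimono_on_if_deriv_neg[where d = "bimodal_slope q"])
       (use c in \<open>auto intro!: bimodal_has_derivative_subset slope_right_neg\<close>)
  \<comment> \<open>Only the left half is bounded directly; reflection then covers the rest.\<close>
  have left_range: "bimodal q x \<in> {0..1/2}" if x: "x \<in> {0..1/2}" for x
  proof -
    consider "x \<le> q" | "q < x" "x < 1/2" | "x = 1/2"
      using x unfolding atLeastAtMost_iff by linarith
    then show ?thesis
    proof cases
      case 1
      then show ?thesis using bimodal_I_L_invariant[of x] x q by auto
    next
      case 2
      then show ?thesis
        using monotone_onD[OF mono, of c x] monotone_onD[OF mono, of x "1/2"] c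
        by (auto simp: zero bimodal_half)
    next
      case 3
      then show ?thesis by (simp only: bimodal_half) simp
    qed
  qed
  have "bimodal q x \<in> {0..1}" if "x \<in> {0..1}" for x
    using left_range[of x] left_range[of "1 - x"] bimodal_symmetric[OF that] that
    by (cases "x \<le> 1/2") auto
  moreover have "bimodal_slope q c = 0"
    using q by (simp add: c_def bimodal_slope_left slope_critical)
  then have "{x \<in> {0..1}. bimodal_slope q x = 0} = {c, 1 - c}"
    using bimodal_slope_neg bimodal_slope_pos slope_right_neg c
    by (auto simp: c_def bimodal_slope_symmetric) (metis linorder_cases less_irrefl)
  then have "\<exists>b'. C1_Lip_deriv (bimodal q) b' \<and> {x \<in> {0..1}. b' x = 0} = {c, 1 - c}"
    using bimodal_has_derivative lipschitz_bimodal_slope unfolding C1_Lip_deriv_def by blast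
  ultimately show ?thesis
    using anti_left mono anti_right zero bimodal_symmetric[of c] bimodal_I_L_invariant c q
    unfolding c_def[symmetric] symmetric_bimodal_crit_def I_L_def bimodal_0
    by (auto simp: bimodal_symmetric)
qed

lemma bimodal_range: "x \<in> {0..1} \<Longrightarrow> bimodal q x \<in> {0..1}"
  using symmetric_bimodal_crit_bimodal unfolding symmetric_bimodal_crit_def by blast

section \<open>Iterates and renormalization\<close>

lemma phi_funpow_range: "y \<in> {0..1} \<Longrightarrow> (phi ^^ n) y \<in> {0..1}"
  by (induction n) (use phi_range in auto)

lemma bimodal_funpow_range: "x \<in> {0..1} \<Longrightarrow> (bimodal q ^^ n) x \<in> {0..1}"
  by (induction n) (use bimodal_range in auto)

text \<open>Multiplication by \<open>q\<close> conjugates \<open>phi\<close> to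
  \<open>bimodal q\<close> on \<open>I_L\<close>, which reduces orbit computations to
  \<open>phi\<close>.\<close>

lemma bimodal_funpow_scaled: "y \<in> {0..1} \<Longrightarrow> (bimodal q ^^ n) (q * y) = q * (phi ^^ n) y"
  by (induction n) (auto simp: bimodal_scaled[OF phi_funpow_range])

lemma bimodal_funpow_symmetric:
  "x \<in> {0..1} \<Longrightarrow> (bimodal q ^^ n) (1 - x) = 1 - (bimodal q ^^ n) x"
  by (induction n) (auto simp: bimodal_symmetric[OF bimodal_funpow_range])

text \<open>The orbit of 0 under \<open>phi\<close> is 0, 1, 17/32, 1/16, 3/4, 9/32; hence
  \<open>I_l\<close> is \<open>q\<close> times \<open>h [0,1]\<close>.\<close>

lemma bimodal_funpow_0: "(bimodal q ^^ 2) 0 = 17/32 * q" "(bimodal q ^^ 5) 0 = 9/32 * q"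
  using bimodal_funpow_scaled[of 0 2] bimodal_funpow_scaled[of 0 5]
  by (simp_all add: numeral_eq_Suc phi_0 phi_left phi_right)

lemma bimodal_funpow_1:
  "(bimodal q ^^ 2) 1 = 1 - 17/32 * q" "(bimodal q ^^ 5) 1 = 1 - 9/32 * q"
  using bimodal_funpow_symmetric[of 0 2] bimodal_funpow_symmetric[of 0 5]
  by (simp_all add: bimodal_funpow_0)

text \<open>The ratio of lengths is 1/4, so \<open>h_l\<close> is \<open>h\<close> conjugated by the
  scaling with \<open>q\<close>.\<close>

lemma bimodal_h_l: "x \<in> {0..q} \<Longrightarrow> h_l (bimodal q) x = 17/32 * q - x / 4"
  using q by (simp add: h_l_def rev_affine_def bimodal_0 bimodal_funpow_0 field_simps)

lemma bimodal_h_r: "x \<in> {1 - q..1} \<Longrightarrow> h_r (bimodal q) x = 1 - (17/32 * q - (1 - x) / 4)"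
  using q by (simp add: h_r_def rev_affine_def bimodal_0 bimodal_funpow_1 field_simps)

lemma bimodal_I_l_eq: "I_l (bimodal q) = (\<lambda>y. q * (17/32 - y / 4)) ` {0..1}"
proof -
  have "x \<in> (\<lambda>y. q * (17/32 - y / 4)) ` {0..1}" if "x \<in> {9/32 * q..17/32 * q}" for x
    \<comment> \<open>The witness is the inverse of \<open>h\<close> at
      \<open>x / q\<close>.\<close>
    using that q by (intro image_eqI[where x = "17/8 - 4 * (x / q)"]) (auto simp: field_simps)
  then show ?thesis
    using q by (auto simp: I_l_def bimodal_funpow_0)
qed

lemma bimodal_I_r_eq: "I_r (bimodal q) = (-) 1 ` I_l (bimodal q)"
  by (simp add: I_r_def I_l_def bimodal_funpow_0 bimodal_funpow_1)

text \<open>In units of \<open>q\<close> the cycle visits \<open>h [0,1]\<close>, [0,1/16] and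
  [3/4,1]; these separated enclosures later give disjointness.\<close>

lemma bimodal_orbit_I_l:
  assumes "x \<in> I_l (bimodal q)"
  shows "bimodal q x \<in> {0..1/16 * q}" "(bimodal q ^^ 2) x \<in> {3/4 * q..q}"
    "(bimodal q ^^ 3) x \<in> I_l (bimodal q)"
proof -
  obtain y where y: "y \<in> {0..1}" "x = q * (17/32 - y / 4)"
    using assms by (auto simp: bimodal_I_l_eq)
  have range: "17/32 - y / 4 \<in> {0..1}" using y by auto
  have phi_y: "0 \<le> phi y" "phi y \<le> 1" using phi_range[OF y(1)] by auto
  have "bimodal q x = q * (phi y / 16)"
    using bimodal_scaled[OF range] y by (simp add: phi_rescale)
  moreover have "0 \<le> q * phi y" "q * phi y \<le> q" using phi_y q by (auto simp: mult_left_le)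
  ultimately show "bimodal q x \<in> {0..1/16 * q}" by simp
  have "(bimodal q ^^ 2) x = q * (1 - phi y / 4)"
    using bimodal_funpow_scaled[OF range, of 2] y phi_y
    by (simp add: numeral_2_eq_2 phi_rescale phi_left)
  then have "(bimodal q ^^ 2) x = q - q * phi y / 4" by (simp add: algebra_simps)
  with \<open>0 \<le> q * phi y\<close> \<open>q * phi y \<le> q\<close> show "(bimodal q ^^ 2) x \<in> {3/4 * q..q}"
    by simp
  have "(bimodal q ^^ 3) x = q * (17/32 - phi y / 4)"
    using bimodal_funpow_scaled[OF range, of 3] y(2) phi_cube_rescale[OF y(1)]
    by (simp add: numeral_3_eq_3)
  then show "(bimodal q ^^ 3) x \<in> I_l (bimodal q)"
    unfolding bimodal_I_l_eq using phi_range[OF y(1)] by blast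
qed

lemma bimodal_I_l_subset: "I_l (bimodal q) \<subseteq> {9/32 * q..17/32 * q}"
  by (simp add: I_l_def bimodal_funpow_0)

lemma bimodal_orbit_I_r:
  assumes "x \<in> I_r (bimodal q)"
  shows "x \<in> {1 - 17/32 * q..1 - 9/32 * q}" "bimodal q x \<in> {1 - 1/16 * q..1}"
    "(bimodal q ^^ 2) x \<in> {1 - q..1 - 3/4 * q}" "(bimodal q ^^ 3) x \<in> I_r (bimodal q)"
proof -
  obtain z where z: "z \<in> I_l (bimodal q)" "x = 1 - z"
    using assms by (auto simp: bimodal_I_r_eq)
  have z01: "z \<in> {0..1}" using z(1) bimodal_I_l_subset q by auto
  show "x \<in> {1 - 17/32 * q..1 - 9/32 * q}" "bimodal q x \<in> {1 - 1/16 * q..1}"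
    "(bimodal q ^^ 2) x \<in> {1 - q..1 - 3/4 * q}"
    using z bimodal_I_l_subset bimodal_orbit_I_l(1,2)[OF z(1)]
      bimodal_symmetric[OF z01] bimodal_funpow_symmetric[OF z01, of 2]
    by auto
  show "(bimodal q ^^ 3) x \<in> I_r (bimodal q)"
    unfolding z(2) bimodal_funpow_symmetric[OF z01] bimodal_I_r_eq
    using bimodal_orbit_I_l(3)[OF z(1)] by (rule imageI)
qed

lemma renormalizable_bimodal: "renormalizable (bimodal q)"
proof -
  have "17/40 * q \<in> I_l (bimodal q)" "1 - 17/40 * q \<in> I_r (bimodal q)"
    using q by (auto simp: I_l_def I_r_def bimodal_funpow_0 bimodal_funpow_1)
  then have "\<exists>c. symmetric_bimodal_crit (bimodal q) c \<and> c \<in> I_l (bimodal q) \<and> 1 - c \<in> I_r (bimodal q)"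
    using symmetric_bimodal_crit_bimodal by blast
  moreover have "(bimodal q ^^ 5) 0 < (bimodal q ^^ 2) 0"
    using q by (simp add: bimodal_funpow_0)
  moreover have l: "bimodal q ` I_l (bimodal q) \<subseteq> {0..1/16 * q}"
      "(bimodal q ^^ 2) ` I_l (bimodal q) \<subseteq> {3/4 * q..q}"
      "(bimodal q ^^ 3) ` I_l (bimodal q) \<subseteq> I_l (bimodal q)"
    using bimodal_orbit_I_l by blast+
  moreover have r: "I_r (bimodal q) \<subseteq> {1 - 17/32 * q..1 - 9/32 * q}"
      "bimodal q ` I_r (bimodal q) \<subseteq> {1 - 1/16 * q..1}"
      "(bimodal q ^^ 2) ` I_r (bimodal q) \<subseteq> {1 - q..1 - 3/4 * q}"
      "(bimodal q ^^ 3) ` I_r (bimodal q) \<subseteq> I_r (bimodal q)"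
    using bimodal_orbit_I_r by blast+
  moreover have disjoint: "A \<inter> B = {}"
    if "A \<subseteq> {a..b}" "B \<subseteq> {c..d}" "b < c \<or> d < a" for A B :: "real set" and a b c d
    using that by fastforce
  have "I_l (bimodal q) \<inter> bimodal q ` I_l (bimodal q) = {}"
    by (rule disjoint[OF bimodal_I_l_subset l(1)]) (use q in simp)
  moreover have "I_l (bimodal q) \<inter> (bimodal q ^^ 2) ` I_l (bimodal q) = {}"
    by (rule disjoint[OF bimodal_I_l_subset l(2)]) (use q in simp)
  moreover have "bimodal q ` I_l (bimodal q) \<inter> (bimodal q ^^ 2) ` I_l (bimodal q) = {}"
    by (rule disjoint[OF l(1,2)]) (use q in simp)
  moreover have "I_r (bimodal q) \<inter> bimodal q ` I_r (bimodal q) = {}"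
    by (rule disjoint[OF r(1,2)]) (use q in simp)
  moreover have "I_r (bimodal q) \<inter> (bimodal q ^^ 2) ` I_r (bimodal q) = {}"
    by (rule disjoint[OF r(1,3)]) (use q in simp)
  moreover have "bimodal q ` I_r (bimodal q) \<inter> (bimodal q ^^ 2) ` I_r (bimodal q) = {}"
    by (rule disjoint[OF r(2,3)]) (use q in simp)
  ultimately show ?thesis
    unfolding renormalizable_def by blast
qed

text \<open>This is \<open>phi_cube_rescale\<close> transported by the scaling with
  \<open>q\<close>.\<close>

lemma bimodal_cube_h_l:
  assumes "x \<in> {0..q}"
  shows "(bimodal q ^^ 3) (h_l (bimodal q) x) = h_l (bimodal q) (bimodal q x)"
proof -
  define y where "y = x / q"
  have y: "y \<in> {0..1}" "x = q * y" using assms q by (auto simp: y_def)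
  have "h_l (bimodal q) x = q * (17/32 - y / 4)"
    using assms by (simp add: bimodal_h_l y(2) algebra_simps)
  moreover have "(bimodal q ^^ 3) (q * (17/32 - y / 4)) = q * (17/32 - phi y / 4)"
    using bimodal_funpow_scaled[of "17/32 - y / 4" 3] y(1) phi_cube_rescale[OF y(1)]
    by (simp add: numeral_3_eq_3)
  moreover have "q * phi y \<in> {0..q}"
    using phi_range[OF y(1)] q by (simp add: mult_left_le)
  then have "h_l (bimodal q) (bimodal q x) = q * (17/32 - phi y / 4)"
    using y by (simp add: bimodal_scaled bimodal_h_l algebra_simps)
  ultimately show ?thesis by simp
qed

text \<open>The free curve over the gap is taken from the map itself. By
  \<open>bimodal_cube_h_l\<close>, \<open>inv_into\<close> only has to undo an injective map at a
  point of \<open>I_L\<close>.\<close>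

lemma is_renormalization_bimodal: "is_renormalization (bimodal q) (bimodal q)"
proof -
  have "bimodal q x = inv_into (I_L (bimodal q)) (h_l (bimodal q))
      ((bimodal q ^^ 3) (h_l (bimodal q) x))" if "x \<in> I_L (bimodal q)" for x
  proof -
    have x: "x \<in> {0..q}" using that by (simp add: I_L_def bimodal_0)
    have "inj_on (h_l (bimodal q)) (I_L (bimodal q))"
      by (auto simp: inj_on_def I_L_def bimodal_0 bimodal_h_l)
    then show ?thesis
      unfolding bimodal_cube_h_l[OF x]
      using bimodal_I_L_invariant[OF x] by (simp add: inv_into_f_f I_L_def bimodal_0)
  qed
  moreover have "bimodal q x = inv_into (I_R (bimodal q)) (h_r (bimodal q))
      ((bimodal q ^^ 3) (h_r (bimodal q) x))" if "x \<in> I_R (bimodal q)" for x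
  proof -
    define z where "z = 1 - x"
    have z: "z \<in> {0..q}" "x = 1 - z" using that by (auto simp: z_def I_R_def bimodal_0)
    have z01: "z \<in> {0..1}" "h_l (bimodal q) z \<in> {0..1}"
      using z(1) q by (auto simp: bimodal_h_l)
    \<comment> \<open>\<open>h_r\<close> is \<open>h_l\<close> reflected, which reduces
      \<open>I_R\<close> to \<open>I_L\<close>.\<close>
    have mirror: "h_r (bimodal q) (1 - y) = 1 - h_l (bimodal q) y" if "y \<in> {0..q}" for y
      using that by (simp add: bimodal_h_l bimodal_h_r)
    have "(bimodal q ^^ 3) (h_r (bimodal q) x) = h_r (bimodal q) (1 - bimodal q z)"
      unfolding z(2) mirror[OF z(1)] bimodal_funpow_symmetric[OF z01(2)] bimodal_cube_h_l[OF z(1)]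
        mirror[OF bimodal_I_L_invariant[OF z(1)]] ..
    also have "1 - bimodal q z = bimodal q x"
      by (simp add: z(2) bimodal_symmetric[OF z01(1)])
    finally have "(bimodal q ^^ 3) (h_r (bimodal q) x) = h_r (bimodal q) (bimodal q x)" .
    moreover have "inj_on (h_r (bimodal q)) (I_R (bimodal q))"
      by (auto simp: inj_on_def I_R_def bimodal_0 bimodal_h_r)
    moreover have "bimodal q x \<in> I_R (bimodal q)"
      using bimodal_I_L_invariant[OF z(1)]
      by (simp add: z(2) bimodal_symmetric[OF z01(1)] I_R_def bimodal_0)
    ultimately show ?thesis by (simp add: inv_into_f_f)
  qed
  ultimately show ?thesis
    using renormalizable_bimodal symmetric_bimodal_crit_bimodal
    unfolding is_renormalization_def symmetric_bimodal_def by blast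
qed

lemma renormalization_fixed_point_bimodal: "renormalization_fixed_point (bimodal q)"
  using is_renormalization_bimodal
  unfolding renormalization_fixed_point_def is_renormalization_def by blast

end

theorem theorem5p1:
  "\<exists>(t0::real) (t1::real) (g :: real \<Rightarrow> real \<Rightarrow> real).
     t0 < t1 \<and>
     (\<forall>t\<in>{t0..t1}. renormalization_fixed_point (g t)) \<and>
     (\<forall>s\<in>{t0..t1}. \<forall>t\<in>{t0..t1}. s \<noteq> t \<longrightarrow> distinct_maps (g s) (g t))"
proof (intro exI conjI ballI impI)
  \<comment> \<open>Any nondegenerate closed interval inside (0,1/2) would serve; the members differ
    at 0.\<close>
  show "(1/4 :: real) < 1/3" by simp
  show "renormalization_fixed_point (bimodal t)" if "t \<in> {1/4..1/3}" for t
    using that by (intro renormalization_fixed_point_bimodal) auto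
  show "distinct_maps (bimodal s) (bimodal t)" if "s \<noteq> t" for s t
    using that by (simp add: distinct_maps_def bimodal_0)
qed

end
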